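(* Let $N$ be a nonnegative integer-valued random variable and let $X_1,X_2,\ldots$ be a sequence of independent and identically distributed nonnegative random variables with finite mean $\mu=\mathrm{E}[X_1]>0$. Let $S_0=0$, $S_n=X_1+\cdots+X_n$ for $n\ge 1$, and $S_N=\sum_{i=1}^N X_i$. Assume that $N$ and $\{X_i\}_{i\ge1}$ are independent. Suppose that the tail of the distribution of $N$ is of consistent variation, that $\mathrm{E}[X_1^r]<\infty$ for some $r>1$, and that one of the following two conditions holds: (1) $\mathrm{E}[N]<\infty$ and $$\Pr[X_1>x]=o(\Pr[N>x]),\qquad x\to\infty;$$ (2) $\mathrm{E}[N]=\infty$ and there exists $q$ with $1\le q<r$ such that $$\limsup_{x\to\infty}\frac{\mathrm{E}[N\,\mathbf 1(N\le x)]}{x^q\,\Pr[N>x]}<\infty.$$ Then $$\Pr[S_N>x]\sim \Pr[N>x/\mu],\qquad x\to\infty.$$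
   Context: For a distribution function $F$, write $\overline F=1-F$. $F$ has a consistently varying tail (its tail is of consistent variation) if $\overline F(x)>0$ for all $x$ and $\lim_{y\uparrow 1}\limsup_{x\to\infty}\overline F(xy)/\overline F(x)=1$. For $N$ this is applied to $F(x)=\Pr[N\le x]$. $\mathbf 1(A)$ is the indicator function of the event $A$. For positive functions $f,g$ defined in a neighbourhood of infinity, $f(x)\sim g(x)$ means $f(x)/g(x)\to 1$; for $g$ positive, $f(x)=o(g(x))$ means $f(x)/g(x)\to 0$, as $x\to\infty$. *)

theory Defs
  imports "HOL-Probability.Probability" "HOL-Library.Landau_Symbols"
begin

definition tail_fun :: "(real \<Rightarrow> real) \<Rightarrow> real \<Rightarrow> real" where
  "tail_fun F x = 1 - F x"

text \<open>The upper limit is taken in the extended reals, since it may be infinite for a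
  distribution function whose tail is not of consistent variation.\<close>

definition consistently_varying_tail :: "(real \<Rightarrow> real) \<Rightarrow> bool" where
  "consistently_varying_tail F \<longleftrightarrow>
     (\<forall>x. tail_fun F x > 0) \<and>
     ((\<lambda>y. Limsup at_top (\<lambda>x. ereal (tail_fun F (x * y) / tail_fun F x))) \<longlongrightarrow> 1) (at_left 1)"

text \<open>The library's \<open>indep_var\<close> requires both random variables to take values in the same
  type, which excludes the independence of a number and a sequence. This is the same notion, the
  independence of the generated sigma-algebras, for values in two different types.\<close>

definition (in prob_space) indep_rvs ::
    "'b measure \<Rightarrow> ('a \<Rightarrow> 'b) \<Rightarrow> 'c measure \<Rightarrow> ('a \<Rightarrow> 'c) \<Rightarrow> bool" where
  "indep_rvs Ma A Mb B \<longleftrightarrow>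
     random_variable Ma A \<and> random_variable Mb B \<and>
     indep_set {A -` S \<inter> space M | S. S \<in> sets Ma} {B -` T \<inter> space M | T. T \<in> sets Mb}"

lemma (in prob_space) indep_rvs_same_type: "indep_rvs Ma A Mb B \<longleftrightarrow> indep_var Ma A Mb B"
proof -
  have sig: "sigma_sets (space M) {f -` S \<inter> space M | S. S \<in> sets K} = {f -` S \<inter> space M | S. S \<in> sets K}"
    if "random_variable K f" for K :: "'b measure" and f
  proof -
    have "f \<in> space M \<rightarrow> space K"
      using measurable_space[OF that] by blast
    from sets_vimage_algebra2[OF this] show ?thesis
      by (simp only: sets_vimage_algebra)
  qed
  show ?thesis
    unfolding indep_rvs_def indep_var_eq by (metis (no_types, lifting) sig)
qed

end

theory Submission
  imports Defs "HOL-Real_Asymp.Real_Asymp"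
begin

text \<open>Lower bound: a Chernoff estimate for nonnegative summands gives \<open>Pr[S m > x] \<rightarrow> 1\<close> for \<open>m\<close>
  slightly above \<open>x / \<mu>\<close>, so \<open>S N\<close> exceeds \<open>x\<close> almost whenever \<open>N\<close> is that large. Upper bound: for
  \<open>n \<le> y x / \<mu>\<close> with \<open>y < 1\<close> the event \<open>S n > x\<close> is a large deviation, and truncating the summands at
  a level \<open>v x\<close> bounds its probability by \<open>n Pr[X 1 > v x] + C x powr (- p)\<close> with \<open>p\<close> as large as
  wanted. Averaging over \<open>N\<close> gives the error \<open>Pr[X 1 > v x] E[N; N \<le> y x / \<mu>] + C x powr (- p)\<close>,
  which is negligible because a consistently varying tail decays at most polynomially and because
  of either of the two conditions. Consistent variation then lets \<open>y\<close> tend to 1.\<close>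

subsection \<open>Consistently varying tails\<close>

text \<open>Iterating the hypothesis shrinks the argument by \<open>y ^ k\<close> at the cost of a
  factor \<open>2 ^ k\<close>. Once \<open>y ^ k < c\<close>, monotonicity passes from
  \<open>y ^ k\<close> to \<open>c\<close>.\<close>

lemma tail_bigo_scale:
  fixes T :: "real \<Rightarrow> real"
  assumes "antimono T" and T_pos: "\<And>x. T x > 0"
    and y: "0 < y" "y < 1" and ev: "eventually (\<lambda>x. T (x * y) \<le> 2 * T x) at_top"
    and c: "c > 0"
  shows "(\<lambda>x. T (c * x)) \<in> O(T)"
proof -
  have step: "eventually (\<lambda>x. T (x * y ^ k) \<le> 2 ^ k * T x) at_top" for k
  proof (induction k)
    case (Suc k)
    have "filterlim (\<lambda>x. x * y ^ k) at_top at_top"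
      using y by (intro filterlim_tendsto_pos_mult_at_top[where c = "y ^ k"] filterlim_at_top_mult_tendsto_pos[where c = "y ^ k"]) (auto simp: filterlim_ident)
    from eventually_compose_filterlim[OF ev this] Suc show ?case
      by eventually_elim (auto simp: algebra_simps)
  qed auto
  obtain k where k: "y ^ k < c"
    using real_arch_pow_inv[OF c y(2)] by blast
  have "eventually (\<lambda>x. norm (T (c * x)) \<le> 2 ^ k * norm (T x)) at_top"
    using step[of k] eventually_ge_at_top[of 0]
  proof eventually_elim
    case (elim x)
    have "T (c * x) \<le> T (x * y ^ k)"
      using mult_left_mono[of "y ^ k" c x] k elim(2)
      by (intro antimonoD[OF assms(1)]) (simp add: mult.commute)
    then show ?case
      using elim T_pos[of x] T_pos[of "c * x"] by simp
  qed
  then show ?thesis by (rule bigoI)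
qed

text \<open>A tail that at most doubles when its argument is multiplied by \<open>y\<close> decays
  no faster than some power, so a steeper power is negligible against it.\<close>

lemma powr_smallo_tail:
  fixes T :: "real \<Rightarrow> real"
  assumes "antimono T" and T_pos: "\<And>x. T x > 0"
    and y: "0 < y" "y < 1" and ev: "eventually (\<lambda>x. T (x * y) \<le> 2 * T x) at_top"
  obtains p where "p > 0" "(\<lambda>x. x powr -p) \<in> o(T)"
proof -
  \<comment> \<open>The solution of \<open>2 * y powr q = 1\<close>: one step by \<open>y\<close>
    may double the tail, and the factor \<open>y powr q\<close> balances this exactly.\<close>
  define q where "q = ln 2 / ln (1 / y)"
  have "ln (1 / y) > 0"
    using y by simp
  then have q: "q > 0" by (simp add: q_def)
  have yq: "2 * y powr q = 1"
  proof -
    have "y powr q = exp (- ln 2)"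
      using y by (simp add: powr_def q_def ln_div)
    then show ?thesis by (simp add: exp_minus)
  qed
  obtain x0 where x0: "x0 > 0" "\<And>x. x \<ge> x0 \<Longrightarrow> T (x * y) \<le> 2 * T x"
    using eventually_conj[OF ev eventually_gt_at_top[of 0]]
    unfolding eventually_at_top_linorder by (metis linorder_not_less order_refl)
  \<comment> \<open>A lower bound of \<open>x powr q * T x\<close> on the interval from
    \<open>x0 * y\<close> to \<open>x0\<close>: each factor is replaced by its value at the less
    favourable endpoint.\<close>
  define c where "c = (x0 * y) powr q * T x0"
  have c: "c > 0" using x0(1) y T_pos by (simp add: c_def)
  \<comment> \<open>The induction counts the steps by \<open>y\<close> that bring \<open>x\<close>
    below \<open>x0\<close>. A point above \<open>x0\<close> takes one step and stays above
    \<open>x0 * y\<close>; for a point at most \<open>x0\<close> the choice of \<open>c\<close>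
    suffices.\<close>
  have bound: "x \<ge> x0 * y \<Longrightarrow> x * y ^ k \<le> x0 \<Longrightarrow> c \<le> x powr q * T x" for x k
  proof (induction k arbitrary: x)
    case 0
    then show ?case
      unfolding c_def using x0(1) y q T_pos
      by (intro mult_mono powr_mono2 antimonoD[OF assms(1)]) (auto intro: less_imp_le)
  next
    case (Suc k)
    have pos: "x > 0" using Suc.prems x0(1) y by (meson less_le_trans mult_pos_pos)
    show ?case
    proof (cases "x \<le> x0")
      case True
      then show ?thesis
        unfolding c_def using x0(1) y q T_pos Suc.prems
        by (intro mult_mono powr_mono2 antimonoD[OF assms(1)]) (auto intro: less_imp_le)
    next
      case False
      have "c \<le> (x * y) powr q * T (x * y)"
        using Suc.prems False y by (intro Suc.IH) (auto simp: algebra_simps)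
      also have "\<dots> \<le> (x * y) powr q * (2 * T x)"
        using x0(2)[of x] False by (intro mult_left_mono) auto
      also have "\<dots> = x powr q * T x * (2 * y powr q)"
        using pos y by (simp add: powr_mult)
      finally show ?thesis by (simp add: yq)
    qed
  qed
  have lower: "c * x powr - q \<le> T x" if x: "x \<ge> x0" for x
  proof -
    have xpos: "x > 0" using x x0(1) by simp
    obtain k where "y ^ k < x0 / x"
      using real_arch_pow_inv[of "x0 / x" y] y x0(1) xpos by auto
    then have "x * y ^ k \<le> x0" using xpos by (simp add: field_simps)
    moreover have "x \<ge> x0 * y"
      using x x0(1) y by (meson less_imp_le mult_left_le order_trans)
    ultimately have "c \<le> x powr q * T x" using bound by blast
    then show ?thesis using xpos by (simp add: powr_minus field_simps)
  qed
  \<comment> \<open>Enlarging the exponent by 1 turns the bound \<open>O(T)\<close> into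
    \<open>o(T)\<close>.\<close>
  have "(\<lambda>x. x powr - (q + 1)) \<in> o(\<lambda>x. x powr - q)"
    by real_asymp
  also have "(\<lambda>x. x powr - q) \<in> O(T)"
  proof (rule bigoI)
    show "eventually (\<lambda>x. norm (x powr - q) \<le> (1 / c) * norm (T x)) at_top"
      using eventually_ge_at_top[of x0]
    proof eventually_elim
      case (elim x)
      then show ?case using lower[of x] c T_pos[of x] by (simp add: field_simps)
    qed
  qed
  finally show ?thesis
    using q by (intro that[of "q + 1"]) auto
qed

text \<open>Since the upper limits tend to 1, some \<open>y\<close> below 1 has an upper limit less
  than \<open>1 + \<epsilon>\<close>. Taking \<open>\<epsilon> = 1\<close> gives the doubling
  hypothesis above; a small \<open>\<epsilon>\<close> gives the sharp constant.\<close>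

lemma consistently_varying_tailD:
  assumes "consistently_varying_tail F" "\<epsilon> > 0"
  obtains y where "0 < y" "y < 1"
    "eventually (\<lambda>x. tail_fun F (x * y) \<le> (1 + \<epsilon>) * tail_fun F x) at_top"
proof -
  have pos: "tail_fun F x > 0" for x
    using assms(1) by (simp add: consistently_varying_tail_def)
  have "eventually (\<lambda>y. Limsup at_top (\<lambda>x. ereal (tail_fun F (x * y) / tail_fun F x)) < ereal (1 + \<epsilon>)) (at_left 1)"
    using assms by (intro order_tendstoD(2)[of _ 1]) (auto simp: consistently_varying_tail_def one_ereal_def)
  moreover have "eventually (\<lambda>y. y \<in> {0<..<1}) (at_left (1::real))"
    by (rule eventually_at_left_real) simp
  ultimately obtain y where y: "y \<in> {0<..<1}"
    "Limsup at_top (\<lambda>x. ereal (tail_fun F (x * y) / tail_fun F x)) < ereal (1 + \<epsilon>)"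
    by (metis (mono_tags, lifting) eventually_conj eventually_happens trivial_limit_at_left_real)
  from Limsup_lessD[OF y(2)] show ?thesis
    using y(1) pos by (intro that[of y]) (auto elim!: eventually_mono simp: field_simps less_imp_le)
qed

subsection \<open>Chernoff estimates for truncated sums\<close>

text \<open>The power series of the left side starts at degree 2, and
  \<open>t ^ n \<le> t\<^sup>2\<close> for \<open>n \<ge> 2\<close> and \<open>t\<close> in the unit
  interval.\<close>

lemma exp_minus_affine_scale:
  fixes t w :: real
  assumes "0 \<le> t" "t \<le> 1" "0 \<le> w"
  shows "exp (t * w) - 1 - t * w \<le> t\<^sup>2 * (exp w - 1 - w)"
proof -
  let ?f = "\<lambda>x::real. \<lambda>n. inverse (fact (n + 2)) *\<^sub>R x ^ (n + 2)"
  have summ: "summable (?f x)" for x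
    by (rule summable_ignore_initial_segment[OF summable_exp_generic])
  have "exp (t * w) - 1 - t * w = (\<Sum>n. ?f (t * w) n)"
    using exp_first_two_terms[of "t * w"] by simp
  also have "\<dots> \<le> (\<Sum>n. t\<^sup>2 * ?f w n)"
  proof (intro suminf_le summ summable_mult)
    fix n
    have "t ^ (n + 2) \<le> t\<^sup>2"
      using assms by (intro power_decreasing) auto
    then have "(t * w) ^ (n + 2) \<le> t\<^sup>2 * w ^ (n + 2)"
      unfolding power_mult_distrib using assms by (intro mult_right_mono) auto
    then show "?f (t * w) n \<le> t\<^sup>2 * ?f w n"
      using mult_left_mono[of "(t * w) ^ (n + 2)" "t\<^sup>2 * w ^ (n + 2)" "inverse (fact (n + 2))"]
      by (simp add: mult.left_commute)
  qed
  also have "\<dots> = t\<^sup>2 * (exp w - 1 - w)"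
    using exp_first_two_terms[of w] by (subst suminf_mult[OF summ]) simp
  finally show ?thesis .
qed

text \<open>Replaces the second-order Taylor bound when only a moment of order \<open>s\<close> is
  at hand: \<open>u\<^sup>2 \<le> u powr s\<close> up to 1, and \<open>u \<le> u powr s\<close>
  beyond.\<close>

lemma exp_minus_le_powr:
  fixes u s :: real
  assumes "0 \<le> u" "1 < s" "s \<le> 2"
  shows "exp (- u) \<le> 1 - u + u powr s"
proof (cases "u \<le> 1")
  case True
  \<comment> \<open>The product \<open>(1 - u + u\<^sup>2) * (1 + u)\<close> is
    \<open>1 + u ^ 3\<close>, hence at least 1.\<close>
  have "(1 - u + u\<^sup>2) * exp u \<ge> (1 - u + u\<^sup>2) * (1 + u)"
    using sum_power2_ge_zero[of "1 - u" u] exp_ge_add_one_self[of u] assms(1) True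
    by (intro mult_left_mono) auto
  moreover have "(1 - u + u\<^sup>2) * (1 + u) \<ge> 1"
    using assms(1) by (simp add: algebra_simps power2_eq_square)
  ultimately have "exp (- u) \<le> 1 - u + u\<^sup>2"
    by (simp add: exp_minus field_simps)
  also have "u\<^sup>2 \<le> u powr s"
    using powr_mono'[of s 2 u] assms True by simp
  finally show ?thesis by simp
next
  case False
  then have "u \<le> u powr s" using powr_mono[of 1 s u] assms by simp
  moreover have "exp (- u) \<le> 1" using assms by simp
  ultimately show ?thesis by linarith
qed

text \<open>The moment order is capped at 2 so that \<open>t\<^sup>2 \<le> t powr s\<close> on the
  unit interval; a higher moment is reduced to this case.\<close>

locale iid_nonneg = prob_space +
  fixes X :: "nat \<Rightarrow> 'a \<Rightarrow> real" and s :: real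
  assumes X_indep: "indep_vars (\<lambda>_. borel) X {1..}"
    and X_ident: "\<And>i. i \<ge> 1 \<Longrightarrow> distr M borel (X i) = distr M borel (X 1)"
    and X_nonneg: "AE \<omega> in M. X 1 \<omega> \<ge> 0"
    and X_integrable: "integrable M (X 1)"
    and s: "1 < s" "s \<le> 2"
    and X_moment: "integrable M (\<lambda>\<omega>. X 1 \<omega> powr s)"
begin

definition S :: "nat \<Rightarrow> 'a \<Rightarrow> real" where
  "S n \<omega> = (\<Sum>i=1..n. X i \<omega>)"

lemma X_measurable: "i \<ge> 1 \<Longrightarrow> X i \<in> borel_measurable M"
  using X_indep by (auto simp: indep_vars_def)

lemma S_measurable [measurable]: "S n \<in> borel_measurable M"
  unfolding S_def using X_measurable by (intro borel_measurable_sum) auto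

lemma AE_X_nonneg: "AE \<omega> in M. \<forall>i\<ge>1. X i \<omega> \<ge> 0"
proof -
  have "AE \<omega> in M. i \<ge> 1 \<longrightarrow> X i \<omega> \<ge> 0" for i
  proof (cases "i \<ge> 1")
    case True
    have "AE x in distr M borel (X i). x \<ge> 0"
      unfolding X_ident[OF True] using X_nonneg X_measurable[of 1] by (subst AE_distr_iff) auto
    then show ?thesis
      using X_measurable[OF True] by (subst (asm) AE_distr_iff) auto
  qed simp
  then show ?thesis by (simp add: AE_all_countable)
qed

lemma prob_X_gt: "i \<ge> 1 \<Longrightarrow> prob {\<omega> \<in> space M. X i \<omega> > x} = prob {\<omega> \<in> space M. X 1 \<omega> > x}"
proof -
  assume i: "i \<ge> 1"
  have "measure (distr M borel (X i)) {x<..} = measure (distr M borel (X 1)) {x<..}"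
    by (simp only: X_ident[OF i])
  then show ?thesis
    using X_measurable[OF i] X_measurable[of 1]
    by (simp add: measure_distr vimage_def Int_def conj_commute)
qed

text \<open>Markov's inequality for the exponential of the sum, whose expectation factorises by
  independence. A general \<open>g\<close> covers both the truncation \<open>h * min x y\<close> for
  upper deviations and \<open>- (h * x)\<close> for lower ones.\<close>

lemma Chernoff_sum:
  fixes g :: "real \<Rightarrow> real"
  assumes g: "g \<in> borel_measurable borel" and int: "integrable M (\<lambda>\<omega>. exp (g (X 1 \<omega>)))"
  shows "prob {\<omega> \<in> space M. (\<Sum>i=1..n. g (X i \<omega>)) \<ge> c} \<le> exp (- c) * (\<integral>\<omega>. exp (g (X 1 \<omega>)) \<partial>M) ^ n"
proof -
  have meas: "(\<lambda>x. exp (g x)) \<in> borel_measurable borel"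
    using g by measurable
  have int_i: "integrable M (\<lambda>\<omega>. exp (g (X i \<omega>)))"
    and eq_i: "(\<integral>\<omega>. exp (g (X i \<omega>)) \<partial>M) = (\<integral>\<omega>. exp (g (X 1 \<omega>)) \<partial>M)" if i: "i \<ge> 1" for i
  proof -
    have "integrable (distr M borel (X i)) (\<lambda>x. exp (g x))"
      unfolding X_ident[OF i] using int meas X_measurable[of 1] by (subst integrable_distr_eq) auto
    then show "integrable M (\<lambda>\<omega>. exp (g (X i \<omega>)))"
      using meas X_measurable[OF i] by (subst (asm) integrable_distr_eq) auto
    have "(\<integral>x. exp (g x) \<partial>distr M borel (X i)) = (\<integral>x. exp (g x) \<partial>distr M borel (X 1))"
      by (simp only: X_ident[OF i])
    then show "(\<integral>\<omega>. exp (g (X i \<omega>)) \<partial>M) = (\<integral>\<omega>. exp (g (X 1 \<omega>)) \<partial>M)"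
      using meas X_measurable[OF i] X_measurable[of 1] by (simp add: integral_distr)
  qed
  have indep: "indep_vars (\<lambda>_. borel) (\<lambda>i \<omega>. exp (g (X i \<omega>))) {1..n}"
    using meas by (intro indep_vars_compose2[OF indep_vars_subset[OF X_indep]]) auto
  have int_prod: "integrable M (\<lambda>\<omega>. \<Prod>i=1..n. exp (g (X i \<omega>)))"
    using int_i by (intro indep_vars_integrable indep) auto
  have "prob {\<omega> \<in> space M. (\<Sum>i=1..n. g (X i \<omega>)) \<ge> c}
      = prob {\<omega> \<in> space M. (\<Prod>i=1..n. exp (g (X i \<omega>))) \<ge> exp c}"
    by (simp add: exp_sum[symmetric])
  also have "\<dots> \<le> (\<integral>\<omega>. (\<Prod>i=1..n. exp (g (X i \<omega>))) \<partial>M) / exp c"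
    using int_prod by (intro integral_Markov_inequality_measure[where A = "{}"]) (auto intro!: AE_I2 prod_nonneg)
  also have "(\<integral>\<omega>. (\<Prod>i=1..n. exp (g (X i \<omega>))) \<partial>M) = (\<Prod>i=1..n. \<integral>\<omega>. exp (g (X i \<omega>)) \<partial>M)"
    using int_i by (intro indep_vars_lebesgue_integral indep) auto
  also have "\<dots> = (\<integral>\<omega>. exp (g (X 1 \<omega>)) \<partial>M) ^ n"
    by (subst prod.cong[OF refl eq_i]) auto
  finally show ?thesis by (simp add: exp_minus field_simps)
qed

text \<open>Truncation bounds the exponential by \<open>exp (h * y)\<close>; the summands themselves
  may have no exponential moment.\<close>

lemma integrable_exp_trunc:
  assumes "h \<ge> 0"
  shows "integrable M (\<lambda>\<omega>. exp (h * min (X 1 \<omega>) y))"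
  using assms X_measurable[of 1]
  by (intro integrable_const_bound[where B = "exp (h * y)"]) (auto intro!: mult_left_mono)

lemma integral_exp_trunc_le:
  assumes h: "h \<ge> 0" and y: "y > 0"
  shows "(\<integral>\<omega>. exp (h * min (X 1 \<omega>) y) \<partial>M)
    \<le> exp (h * (\<integral>\<omega>. X 1 \<omega> \<partial>M) + exp (h * y) * y powr - s * (\<integral>\<omega>. X 1 \<omega> powr s \<partial>M))"
proof -
  have pointwise: "exp (h * min x y) \<le> 1 + h * x + exp (h * y) * y powr - s * x powr s" if x: "x \<ge> 0" for x
  proof -
    \<comment> \<open>Writing the truncated value as \<open>t * y\<close> lets the scaling
      inequality separate a linear part, at most \<open>h * x\<close>, from a remainder with factor
      \<open>t\<^sup>2\<close>, at most \<open>(x / y) powr s\<close>.\<close>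
    define t where "t = min x y / y"
    have t: "0 \<le> t" "t \<le> 1" "t \<le> x / y" using x y by (auto simp: t_def divide_right_mono)
    have "exp (h * min x y) = exp (t * (h * y))" using y by (simp add: t_def)
    also have "\<dots> \<le> 1 + t * (h * y) + t\<^sup>2 * (exp (h * y) - 1 - h * y)"
      using exp_minus_affine_scale[of t "h * y"] t h y by simp
    finally have "exp (h * min x y) \<le> 1 + t * (h * y) + t\<^sup>2 * (exp (h * y) - 1 - h * y)" .
    moreover have "t * (h * y) \<le> h * x"
      using mult_left_mono[OF t(3), of "h * y"] h y by (simp add: field_simps)
    moreover have "t\<^sup>2 * (exp (h * y) - 1 - h * y) \<le> (x / y) powr s * exp (h * y)"
    proof (rule mult_mono)
      have "t\<^sup>2 \<le> t powr s"
        using powr_mono'[of s 2 t] s t by simp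
      also have "\<dots> \<le> (x / y) powr s"
        using t s by (intro powr_mono2) auto
      finally show "t\<^sup>2 \<le> (x / y) powr s" .
      show "exp (h * y) - 1 - h * y \<le> exp (h * y)" using mult_nonneg_nonneg[of h y] h y by linarith
      show "0 \<le> exp (h * y) - 1 - h * y" using exp_ge_add_one_self[of "h * y"] by linarith
    qed simp
    moreover have "(x / y) powr s * exp (h * y) = exp (h * y) * y powr - s * x powr s"
      using x y by (simp add: powr_divide powr_minus_divide)
    ultimately show ?thesis by linarith
  qed
  have "(\<integral>\<omega>. exp (h * min (X 1 \<omega>) y) \<partial>M)
      \<le> (\<integral>\<omega>. 1 + h * X 1 \<omega> + exp (h * y) * y powr - s * X 1 \<omega> powr s \<partial>M)"
    using X_nonneg X_integrable X_moment
    by (intro integral_mono_AE integrable_exp_trunc h) (auto intro: pointwise)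
  also have "\<dots> = 1 + (h * (\<integral>\<omega>. X 1 \<omega> \<partial>M) + exp (h * y) * y powr - s * (\<integral>\<omega>. X 1 \<omega> powr s \<partial>M))"
    using X_integrable X_moment by (simp add: prob_space)
  also have "\<dots> \<le> exp (h * (\<integral>\<omega>. X 1 \<omega> \<partial>M) + exp (h * y) * y powr - s * (\<integral>\<omega>. X 1 \<omega> powr s \<partial>M))"
    by (rule exp_ge_add_one_self)
  finally show ?thesis .
qed

text \<open>The truncation level is \<open>y = v x\<close> with \<open>v = (s - 1) / p\<close> and the Chernoff parameter is
  \<open>h = (s - 1) ln y / y\<close>, so that \<open>exp (h y) = y powr (s - 1)\<close> and \<open>exp (- h x) = y powr (- p)\<close>.\<close>

lemma Fuk_Nagaev:
  assumes p: "p > 0" and B: "B > 0"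
  obtains v C where "v > 0" "C > 0"
    "\<And>n x. real n \<le> B * x \<Longrightarrow> x \<ge> 1 / v \<Longrightarrow>
       prob {\<omega> \<in> space M. S n \<omega> > real n * (\<integral>\<omega>. X 1 \<omega> \<partial>M) + x}
         \<le> real n * prob {\<omega> \<in> space M. X 1 \<omega> > v * x} + C * x powr - p"
proof -
  define \<mu> where "\<mu> = (\<integral>\<omega>. X 1 \<omega> \<partial>M)"
  define K where "K = (\<integral>\<omega>. X 1 \<omega> powr s \<partial>M)"
  define v where "v = (s - 1) / p"
  define C where "C = exp (B * K / v) * v powr - p"
  have K: "K \<ge> 0" by (simp add: K_def)
  have v: "v > 0" using s p by (simp add: v_def)
  have "prob {\<omega> \<in> space M. S n \<omega> > real n * \<mu> + x}
         \<le> real n * prob {\<omega> \<in> space M. X 1 \<omega> > v * x} + C * x powr - p"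
    if n: "real n \<le> B * x" and x: "x \<ge> 1 / v" for n x
  proof -
    define y where "y = v * x"
    define h where "h = (s - 1) * ln y / y"
    have x0: "x > 0" using x v by (meson less_le_trans zero_less_divide_1_iff)
    \<comment> \<open>The threshold on \<open>x\<close> is chosen for this: it makes
      \<open>ln y\<close>, and so \<open>h\<close>, nonnegative.\<close>
    have y: "y \<ge> 1" using x v by (simp add: y_def field_simps)
    have h: "h \<ge> 0" using y s by (simp add: h_def)
    have hy: "exp (h * y) = y powr (s - 1)" using y by (simp add: h_def powr_def)
    have "h * x = p * ln y"
      using v x0 p s by (simp add: h_def y_def v_def)
    then have hx: "exp (- (h * x)) = y powr - p"
      using y by (simp add: powr_def)
    let ?trunc = "{\<omega> \<in> space M. (\<Sum>i=1..n. h * min (X i \<omega>) y) \<ge> h * (real n * \<mu> + x)}"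
    let ?big = "\<lambda>i. {\<omega> \<in> space M. X i \<omega> > y}"
    have meas: "?trunc \<in> events" "\<And>i. i \<in> {1..n} \<Longrightarrow> ?big i \<in> events"
    proof -
      have "(\<lambda>\<omega>. \<Sum>i=1..n. h * min (X i \<omega>) y) \<in> borel_measurable M"
        using X_measurable by (intro borel_measurable_sum) auto
      then show "?trunc \<in> events" by measurable
      show "?big i \<in> events" if "i \<in> {1..n}" for i
      proof -
        have [measurable]: "X i \<in> borel_measurable M" using that by (intro X_measurable) simp
        show ?thesis by measurable
      qed
    qed
    have "prob {\<omega> \<in> space M. S n \<omega> > real n * \<mu> + x} \<le> prob ((\<Union>i\<in>{1..n}. ?big i) \<union> ?trunc)"
    proof (intro finite_measure_mono subsetI)
      fix \<omega> assume \<omega>: "\<omega> \<in> {\<omega> \<in> space M. S n \<omega> > real n * \<mu> + x}"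
      show "\<omega> \<in> (\<Union>i\<in>{1..n}. ?big i) \<union> ?trunc"
      \<comment> \<open>If no summand exceeds \<open>y\<close>, truncation changes nothing, so the
        truncated sum is large. The inequality in \<open>?trunc\<close> is weak because
        \<open>h\<close> vanishes when \<open>y = 1\<close>.\<close>
      proof (cases "\<exists>i\<in>{1..n}. X i \<omega> > y")
        case False
        then have "(\<Sum>i=1..n. h * min (X i \<omega>) y) = h * S n \<omega>"
          unfolding S_def sum_distrib_left by (intro sum.cong refl) (auto simp: min_def not_less)
        moreover have "h * (real n * \<mu> + x) \<le> h * S n \<omega>"
          using \<omega> h by (intro mult_left_mono) auto
        ultimately show ?thesis using \<omega> by simp
      qed (use \<omega> in auto)
    qed (use meas in auto)
    also have "\<dots> \<le> prob (\<Union>i\<in>{1..n}. ?big i) + prob ?trunc"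
      by (rule measure_Un_le[OF sets.finite_UN[OF _ meas(2)] meas(1)]) auto
    finally have split: "prob {\<omega> \<in> space M. S n \<omega> > real n * \<mu> + x}
      \<le> prob (\<Union>i\<in>{1..n}. ?big i) + prob ?trunc" .
    have "prob (\<Union>i\<in>{1..n}. ?big i) \<le> (\<Sum>i\<in>{1..n}. prob (?big i))"
      using meas(2) by (intro finite_measure_subadditive_finite) blast+
    also have "\<dots> = (\<Sum>i\<in>{1..n}. prob (?big 1))"
      by (intro sum.cong refl prob_X_gt) simp
    finally have big: "prob (\<Union>i\<in>{1..n}. ?big i) \<le> real n * prob (?big 1)" by simp
    have trunc: "prob ?trunc \<le> C * x powr - p"
    proof -
      have "prob ?trunc \<le> exp (- (h * (real n * \<mu> + x))) * (\<integral>\<omega>. exp (h * min (X 1 \<omega>) y) \<partial>M) ^ n"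
        using integrable_exp_trunc[OF h] by (intro Chernoff_sum) auto
      also have "\<dots> \<le> exp (- (h * (real n * \<mu> + x))) * exp (h * \<mu> + exp (h * y) * y powr - s * K) ^ n"
        using integral_exp_trunc_le[OF h, of y] y
        by (intro mult_left_mono power_mono) (auto simp: \<mu>_def K_def)
      \<comment> \<open>Beyond the mean, each factor thus contributes only \<open>K / y\<close> to
        the exponent; \<open>n\<close> factors contribute at most \<open>B * K / v\<close>, since
        \<open>n \<le> B * x\<close> and \<open>y = v * x\<close>.\<close>
      also have "exp (h * y) * y powr - s = 1 / y"
        unfolding hy using y powr_add[of y "s - 1" "- s"] by (simp add: powr_minus_divide)
      also have "exp (- (h * (real n * \<mu> + x))) * exp (h * \<mu> + 1 / y * K) ^ n
          = exp (real n / y * K) * exp (- (h * x))"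
        unfolding exp_of_nat_mult[symmetric] exp_add[symmetric] by (simp add: algebra_simps)
      also have "\<dots> \<le> exp (B * K / v) * exp (- (h * x))"
      proof -
        have "real n / y \<le> B / v"
          using n v x0 by (simp add: y_def field_simps)
        from mult_right_mono[OF this K] show ?thesis by simp
      qed
      also have "exp (- (h * x)) = v powr - p * x powr - p"
        unfolding hx y_def using v x0 by (simp add: powr_mult)
      finally show ?thesis by (simp add: C_def mult.assoc)
    qed
    show ?thesis using split big trunc unfolding y_def by linarith
  qed
  then show ?thesis
    using v that[of v C] by (auto simp: C_def \<mu>_def)
qed

text \<open>Nonnegative summands have finite negative exponential moments, so a Chernoff bound with
  a fixed small \<open>h\<close> makes the probability geometrically small.\<close>

lemma prob_S_le_tendsto_0:
  assumes y: "y < 1" and mean: "(\<integral>\<omega>. X 1 \<omega> \<partial>M) > 0"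
  shows "(\<lambda>n. prob {\<omega> \<in> space M. S n \<omega> \<le> real n * (y * (\<integral>\<omega>. X 1 \<omega> \<partial>M))}) \<longlonglongrightarrow> 0"
proof -
  define \<mu> where "\<mu> = (\<integral>\<omega>. X 1 \<omega> \<partial>M)"
  define K where "K = (\<integral>\<omega>. X 1 \<omega> powr s \<partial>M)"
  have K: "K \<ge> 0" by (simp add: K_def)
  \<comment> \<open>For small \<open>h\<close> the moment term \<open>h powr s * K\<close> is below
    the linear gain \<open>h * \<mu> * (1 - y)\<close>, which makes the exponent of
    \<open>\<rho>\<close> negative.\<close>
  have "((\<lambda>h. h powr (s - 1) * K) \<longlongrightarrow> 0) (at_right 0)"
    using s by real_asymp
  then have "eventually (\<lambda>h. h powr (s - 1) * K < \<mu> * (1 - y)) (at_right 0)"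
    using y mean by (intro order_tendstoD) (auto simp: \<mu>_def)
  moreover have "eventually (\<lambda>h. h > 0) (at_right (0::real))"
    by (simp add: eventually_at_right_less)
  ultimately obtain h where h: "h > 0" "h powr (s - 1) * K < \<mu> * (1 - y)"
    by (metis (mono_tags, lifting) eventually_conj eventually_happens trivial_limit_at_right_real)
  define \<rho> where "\<rho> = exp (h * (y * \<mu>) - h * \<mu> + h powr s * K)"
  have "h powr s = h * h powr (s - 1)"
    using h by (simp add: powr_diff)
  then have "h * (y * \<mu>) - h * \<mu> + h powr s * K = h * (h powr (s - 1) * K - \<mu> * (1 - y))"
    by (simp add: algebra_simps)
  also have "\<dots> < 0" using h by (simp add: mult_pos_neg)
  finally have \<rho>: "0 < \<rho>" "\<rho> < 1" by (auto simp: \<rho>_def)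
  have int: "integrable M (\<lambda>\<omega>. exp (- (h * X 1 \<omega>)))"
    using X_nonneg h X_measurable[of 1]
    by (intro integrable_const_bound[where B = 1]) auto
  have mgf: "(\<integral>\<omega>. exp (- (h * X 1 \<omega>)) \<partial>M) \<le> exp (- (h * \<mu>) + h powr s * K)"
  proof -
    have "(\<integral>\<omega>. exp (- (h * X 1 \<omega>)) \<partial>M) \<le> (\<integral>\<omega>. 1 - h * X 1 \<omega> + h powr s * X 1 \<omega> powr s \<partial>M)"
      using X_nonneg X_integrable X_moment int
    proof (intro integral_mono_AE)
      show "AE \<omega> in M. exp (- (h * X 1 \<omega>)) \<le> 1 - h * X 1 \<omega> + h powr s * X 1 \<omega> powr s"
        using X_nonneg
      proof eventually_elim
        case (elim \<omega>)
        then show ?case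
          using exp_minus_le_powr[of "h * X 1 \<omega>" s] h s by (simp add: powr_mult)
      qed
    qed auto
    also have "\<dots> = 1 + (- (h * \<mu>) + h powr s * K)"
      using X_integrable X_moment by (simp add: prob_space \<mu>_def K_def)
    also have "\<dots> \<le> exp (- (h * \<mu>) + h powr s * K)"
      by (rule exp_ge_add_one_self)
    finally show ?thesis .
  qed
  have bound: "prob {\<omega> \<in> space M. S n \<omega> \<le> real n * (y * \<mu>)} \<le> \<rho> ^ n" for n
  proof -
    have "{\<omega> \<in> space M. S n \<omega> \<le> real n * (y * \<mu>)}
        = {\<omega> \<in> space M. (\<Sum>i=1..n. - (h * X i \<omega>)) \<ge> - (h * (real n * (y * \<mu>)))}"
      using h by (simp add: S_def sum_negf flip: sum_distrib_left)
    then have "prob {\<omega> \<in> space M. S n \<omega> \<le> real n * (y * \<mu>)}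
        \<le> exp (- (- (h * (real n * (y * \<mu>))))) * (\<integral>\<omega>. exp (- (h * X 1 \<omega>)) \<partial>M) ^ n"
      using int by (simp only:) (intro Chernoff_sum, auto)
    also have "\<dots> \<le> exp (- (- (h * (real n * (y * \<mu>))))) * exp (- (h * \<mu>) + h powr s * K) ^ n"
      by (intro mult_left_mono power_mono mgf) auto
    also have "\<dots> = \<rho> ^ n"
      unfolding \<rho>_def exp_of_nat_mult[symmetric] exp_add[symmetric] by (simp add: algebra_simps)
    finally show ?thesis .
  qed
  have "(\<lambda>n. \<rho> ^ n) \<longlonglongrightarrow> 0"
    using \<rho> by (intro LIMSEQ_realpow_zero) auto
  then show ?thesis
    unfolding \<mu>_def[symmetric]
    by (rule tendsto_sandwich[OF _ _ tendsto_const, rotated 2]) (auto simp: bound)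
qed

end

subsection \<open>Random sums\<close>

text \<open>Markov's inequality for \<open>Y powr r\<close>, with the moment as the implied
  constant.\<close>

lemma (in prob_space) prob_gt_bigo_powr:
  fixes Y :: "'a \<Rightarrow> real"
  assumes Y [measurable]: "Y \<in> borel_measurable M"
    and r: "r > 0" and int: "integrable M (\<lambda>\<omega>. Y \<omega> powr r)"
  shows "(\<lambda>x. prob {\<omega> \<in> space M. Y \<omega> > x}) \<in> O(\<lambda>x. x powr - r)"
proof (rule bigoI)
  show "eventually (\<lambda>x. norm (prob {\<omega> \<in> space M. Y \<omega> > x})
      \<le> (\<integral>\<omega>. Y \<omega> powr r \<partial>M) * norm (x powr - r)) at_top"
    using eventually_gt_at_top[of 0]
  proof eventually_elim
    case (elim x)
    have "prob {\<omega> \<in> space M. Y \<omega> > x} \<le> prob {\<omega> \<in> space M. Y \<omega> powr r \<ge> x powr r}"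
      using elim r by (intro finite_measure_mono) (auto intro!: powr_mono2)
    also have "\<dots> \<le> (\<integral>\<omega>. Y \<omega> powr r \<partial>M) / x powr r"
      using int elim by (intro integral_Markov_inequality_measure[where A = "{}"]) auto
    finally show ?case by (simp add: powr_minus_divide)
  qed
qed

lemma (in finite_measure) integrable_powr_le:
  fixes Y :: "'a \<Rightarrow> real"
  assumes [measurable]: "Y \<in> borel_measurable M" and "AE \<omega> in M. Y \<omega> \<ge> 0"
    and "0 < s" "s \<le> r" and "integrable M (\<lambda>\<omega>. Y \<omega> powr r)"
  shows "integrable M (\<lambda>\<omega>. Y \<omega> powr s)"
proof (rule Bochner_Integration.integrable_bound)
  show "integrable M (\<lambda>\<omega>. 1 + Y \<omega> powr r)" using assms by simp
  show "AE \<omega> in M. norm (Y \<omega> powr s) \<le> norm (1 + Y \<omega> powr r)"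
    using assms(2)
  proof eventually_elim
    case (elim \<omega>)
    show ?case
    proof (cases "Y \<omega> \<le> 1")
      case True
      have "Y \<omega> powr s \<le> 1" using powr_mono2[of s "Y \<omega>" 1] True elim assms(3) by simp
      also have "1 \<le> 1 + Y \<omega> powr r" by simp
      finally show ?thesis by simp
    next
      case False
      then have "Y \<omega> powr s \<le> Y \<omega> powr r" using assms by (intro powr_mono) auto
      then show ?thesis by simp
    qed
  qed
qed measurable

lemma filterlim_divide_at_top:
  fixes c :: real
  assumes "c > 0"
  shows "filterlim (\<lambda>x. x / c) at_top at_top"
  using assms by real_asymp

section \<open>Random sums with an index independent of the summands\<close>

locale random_sum = iid_nonneg +
  fixes N :: "'a \<Rightarrow> nat"
  assumes N_X_indep: "indep_rvs (count_space UNIV) N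
      (PiM {1..} (\<lambda>_. borel)) (\<lambda>\<omega>. \<lambda>i\<in>{1..}. X i \<omega>)"
begin

lemma N_measurable [measurable]: "N \<in> measurable M (count_space UNIV)"
  using N_X_indep by (simp add: indep_rvs_def)

definition T :: "real \<Rightarrow> real" where
  "T x = prob {\<omega> \<in> space M. real (N \<omega>) > x}"

text \<open>The truncated mean of \<open>N\<close>, which arises when the single-jump bound
  \<open>n * Pr[X 1 > v x]\<close> is averaged over the values \<open>n\<close> of \<open>N\<close>.
  It is finite even if \<open>N\<close> has infinite mean.\<close>

definition G :: "real \<Rightarrow> real" where
  "G x = (\<integral>\<omega>. real (N \<omega>) * indicator {\<omega>. real (N \<omega>) \<le> x} \<omega> \<partial>M)"

lemma antimono_T: "antimono T"
  unfolding T_def by (intro antimonoI finite_measure_mono) auto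

lemma tail_fun_N: "tail_fun (cdf (distr M borel (\<lambda>\<omega>. real (N \<omega>)))) x = T x"
proof -
  have "cdf (distr M borel (\<lambda>\<omega>. real (N \<omega>))) x = prob {\<omega> \<in> space M. real (N \<omega>) \<le> x}"
    by (simp add: cdf_def measure_distr vimage_def Int_def conj_commute)
  also have "\<dots> = 1 - prob {\<omega> \<in> space M. \<not> real (N \<omega>) \<le> x}"
    by (subst prob_neg) auto
  finally show ?thesis by (simp add: tail_fun_def T_def not_le)
qed

lemma S_random_measurable [measurable]: "(\<lambda>\<omega>. S (N \<omega>) \<omega>) \<in> borel_measurable M"
  by (rule measurable_compose_countable[OF S_measurable N_measurable])

text \<open>As \<open>S n\<close> is a measurable function of the sequence, independence of
  \<open>N\<close> and the sequence passes to \<open>N\<close> and \<open>S n\<close>. The set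
  \<open>A\<close> is later a half-line or a singleton.\<close>

lemma prob_N_S:
  "prob {\<omega> \<in> space M. N \<omega> \<in> A \<and> S n \<omega> > x}
    = prob {\<omega> \<in> space M. N \<omega> \<in> A} * prob {\<omega> \<in> space M. S n \<omega> > x}"
proof -
  let ?P = "PiM {1::nat..} (\<lambda>_. borel :: real measure)"
  let ?T = "{w \<in> space ?P. (\<Sum>i=1..n. w i) > x}"
  have T: "?T \<in> sets ?P"
  proof -
    have "(\<lambda>w. \<Sum>i=1..n. w i) \<in> borel_measurable ?P"
      by (intro borel_measurable_sum measurable_component_singleton) auto
    then show ?thesis by measurable
  qed
  have S: "{\<omega> \<in> space M. S n \<omega> > x} = (\<lambda>\<omega>. \<lambda>i\<in>{1..}. X i \<omega>) -` ?T \<inter> space M"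
    by (auto simp: S_def space_PiM)
  have "prob ((N -` A \<inter> space M) \<inter> {\<omega> \<in> space M. S n \<omega> > x})
      = prob (N -` A \<inter> space M) * prob {\<omega> \<in> space M. S n \<omega> > x}"
    unfolding S
  proof (rule indep_setD)
    show "indep_set {N -` A \<inter> space M | A. A \<in> sets (count_space UNIV)}
        {(\<lambda>\<omega>. \<lambda>i\<in>{1..}. X i \<omega>) -` T \<inter> space M | T. T \<in> sets ?P}"
      using N_X_indep by (simp add: indep_rvs_def)
    show "N -` A \<inter> space M \<in> {N -` A \<inter> space M | A. A \<in> sets (count_space UNIV)}"
      by auto
    show "(\<lambda>\<omega>. \<lambda>i\<in>{1..}. X i \<omega>) -` ?T \<inter> space M
        \<in> {(\<lambda>\<omega>. \<lambda>i\<in>{1..}. X i \<omega>) -` T \<inter> space M | T. T \<in> sets ?P}"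
      using T by blast
  qed
  moreover have "(N -` A \<inter> space M) \<inter> {\<omega> \<in> space M. S n \<omega> > x}
      = {\<omega> \<in> space M. N \<omega> \<in> A \<and> S n \<omega> > x}"
    and "N -` A \<inter> space M = {\<omega> \<in> space M. N \<omega> \<in> A}"
    by auto
  ultimately show ?thesis by simp
qed

text \<open>Here \<open>m\<close> is the least integer above \<open>z\<close>, so
  \<open>N > z\<close> means \<open>N \<ge> m\<close>. Then \<open>S m \<le> S N\<close> almost
  surely, and independence factorises the probability.\<close>

lemma random_sum_ge:
  assumes "m = Suc (nat \<lfloor>z\<rfloor>)" "z \<ge> 0"
  shows "T z * prob {\<omega> \<in> space M. S m \<omega> > x} \<le> prob {\<omega> \<in> space M. S (N \<omega>) \<omega> > x}"
proof -
  have "{\<omega> \<in> space M. real (N \<omega>) > z} = {\<omega> \<in> space M. N \<omega> \<in> {m..}}"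
    using assms by (auto simp: Suc_le_eq) linarith+
  then have "T z * prob {\<omega> \<in> space M. S m \<omega> > x}
      = prob {\<omega> \<in> space M. N \<omega> \<in> {m..} \<and> S m \<omega> > x}"
    unfolding prob_N_S T_def by simp
  also have "\<dots> \<le> prob {\<omega> \<in> space M. S (N \<omega>) \<omega> > x}"
  proof (intro finite_measure_mono_AE)
    show "AE \<omega> in M. \<omega> \<in> {\<omega> \<in> space M. N \<omega> \<in> {m..} \<and> S m \<omega> > x} \<longrightarrow>
        \<omega> \<in> {\<omega> \<in> space M. S (N \<omega>) \<omega> > x}"
      using AE_X_nonneg
    proof eventually_elim
      case (elim \<omega>)
      have "S m \<omega> \<le> S (N \<omega>) \<omega>" if "m \<le> N \<omega>"
        unfolding S_def using elim that by (intro sum_mono2) auto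
      then show ?case by auto
    qed
  qed measurable
  finally show ?thesis .
qed

text \<open>All of the event \<open>N > z\<close> is given away; on its complement the finitely many
  values of \<open>N\<close> are treated separately by independence.\<close>

lemma random_sum_le:
  assumes "z \<ge> 0"
  shows "prob {\<omega> \<in> space M. S (N \<omega>) \<omega> > x}
    \<le> T z + (\<Sum>n\<le>nat \<lfloor>z\<rfloor>. prob {\<omega> \<in> space M. N \<omega> = n} * prob {\<omega> \<in> space M. S n \<omega> > x})"
proof -
  let ?E = "\<lambda>n. {\<omega> \<in> space M. N \<omega> \<in> {n} \<and> S n \<omega> > x}"
  have "prob {\<omega> \<in> space M. S (N \<omega>) \<omega> > x}
      \<le> prob ({\<omega> \<in> space M. real (N \<omega>) > z} \<union> (\<Union>n\<in>{..nat \<lfloor>z\<rfloor>}. ?E n))"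
    using assms by (intro finite_measure_mono) (auto simp: le_nat_iff le_floor_iff)
  also have "\<dots> \<le> T z + prob (\<Union>n\<in>{..nat \<lfloor>z\<rfloor>}. ?E n)"
    unfolding T_def by (intro measure_Un_le) auto
  also have "prob (\<Union>n\<in>{..nat \<lfloor>z\<rfloor>}. ?E n) \<le> (\<Sum>n\<le>nat \<lfloor>z\<rfloor>. prob (?E n))"
    by (intro finite_measure_subadditive_finite) auto
  finally show ?thesis unfolding prob_N_S by simp
qed

lemma G_eq_sum:
  assumes "z \<ge> 0"
  shows "G z = (\<Sum>n\<le>nat \<lfloor>z\<rfloor>. real n * prob {\<omega> \<in> space M. N \<omega> = n})"
proof -
  have "real (N \<omega>) * indicator {\<omega>. real (N \<omega>) \<le> z} \<omega>
      = (\<Sum>n\<le>nat \<lfloor>z\<rfloor>. real n * indicator {\<omega> \<in> space M. N \<omega> = n} \<omega>)" if "\<omega> \<in> space M" for \<omega>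
  proof -
    have "(\<Sum>n\<le>nat \<lfloor>z\<rfloor>. real n * indicator {\<omega> \<in> space M. N \<omega> = n} \<omega>)
        = (\<Sum>n\<le>nat \<lfloor>z\<rfloor>. if n = N \<omega> then real (N \<omega>) else 0)"
      using that by (intro sum.cong) (auto simp: indicator_def)
    then show ?thesis
      using assms by (auto simp: indicator_def le_nat_iff le_floor_iff)
  qed
  then have "G z = (\<integral>\<omega>. (\<Sum>n\<le>nat \<lfloor>z\<rfloor>. real n * indicator {\<omega> \<in> space M. N \<omega> = n} \<omega>) \<partial>M)"
    unfolding G_def by (intro Bochner_Integration.integral_cong) auto
  also have "\<dots> = (\<Sum>n\<le>nat \<lfloor>z\<rfloor>. real n * prob {\<omega> \<in> space M. N \<omega> = n})"
    by (subst Bochner_Integration.integral_sum)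
       (auto intro!: sum.cong integrable_real_indicator simp: emeasure_eq_measure)
  finally show ?thesis .
qed

lemma G_nonneg: "G z \<ge> 0"
  unfolding G_def by (intro Bochner_Integration.integral_nonneg) auto

lemma prob_N_sum_le_1: "(\<Sum>n\<le>k. prob {\<omega> \<in> space M. N \<omega> = n}) \<le> 1"
proof -
  have "(\<Sum>n\<le>k. prob {\<omega> \<in> space M. N \<omega> = n}) = prob (\<Union>n\<in>{..k}. {\<omega> \<in> space M. N \<omega> = n})"
    by (intro finite_measure_finite_Union[symmetric]) (auto simp: disjoint_family_on_def)
  then show ?thesis by simp
qed

text \<open>If \<open>N\<close> exceeds \<open>x / \<mu>\<close> by a fixed factor
  \<open>1 / y\<close>, the weak law makes \<open>S N > x\<close> likely. Consistent variation
  bounds the loss from moving the threshold of \<open>N\<close>.\<close>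

lemma random_sum_lower:
  assumes cv: "consistently_varying_tail (cdf (distr M borel (\<lambda>\<omega>. real (N \<omega>))))"
    and \<mu>: "\<mu> = (\<integral>\<omega>. X 1 \<omega> \<partial>M)" "\<mu> > 0" and c: "c > 0"
  shows "eventually (\<lambda>x. (1 - c) * T (x / \<mu>) \<le> prob {\<omega> \<in> space M. S (N \<omega>) \<omega> > x}) at_top"
proof -
  \<comment> \<open>The two losses combine as
    \<open>(1 - c) * (1 + e) \<le> (1 - 2 * e) * (1 + e) \<le> 1 - e\<close>, which uses
    \<open>e \<le> c / 2\<close>.\<close>
  define e where "e = min (c / 2) (1 / 2)"
  have e: "0 < e" "e \<le> c / 2" "e \<le> 1 / 2" using c by (auto simp: e_def)
  obtain y where y: "0 < y" "y < 1" and ev: "eventually (\<lambda>x. T (x * y) \<le> (1 + e) * T x) at_top"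
    using consistently_varying_tailD[OF cv e(1)] unfolding tail_fun_N by blast
  \<comment> \<open>This makes \<open>z x * y = x / \<mu>\<close>, and \<open>m > z x\<close> yields
    \<open>m * (y * \<mu>) > x\<close>, the level at which the lower deviation estimate
    applies.\<close>
  define z where "z = (\<lambda>x. x / (\<mu> * y))"
  have z_lim: "filterlim z at_top at_top"
    unfolding z_def using \<mu> y by (intro filterlim_divide_at_top) simp
  define m where "m = (\<lambda>x. Suc (nat \<lfloor>z x\<rfloor>))"
  have m_lim: "filterlim m sequentially at_top"
    unfolding m_def
    by (intro filterlim_compose[OF filterlim_Suc] filterlim_compose[OF filterlim_nat_sequentially]
          filterlim_compose[OF filterlim_floor_sequentially] z_lim)
  have "eventually (\<lambda>n. prob {\<omega> \<in> space M. S n \<omega> \<le> real n * (y * \<mu>)} < e) sequentially"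
    using prob_S_le_tendsto_0[OF y(2)] \<mu> e by (auto dest: order_tendstoD(2))
  from eventually_compose_filterlim[OF this m_lim] eventually_compose_filterlim[OF ev z_lim]
    eventually_ge_at_top[of 0]
  show ?thesis
  proof eventually_elim
    case (elim x)
    have z0: "z x \<ge> 0" using elim \<mu> y by (simp add: z_def)
    have "z x < real (m x)" unfolding m_def using z0 by linarith
    then have mx: "x < real (m x) * (y * \<mu>)" using \<mu> y by (simp add: z_def field_simps)
    have "prob {\<omega> \<in> space M. S (m x) \<omega> > x} = 1 - prob {\<omega> \<in> space M. \<not> S (m x) \<omega> > x}"
      by (subst prob_neg) auto
    moreover have "prob {\<omega> \<in> space M. \<not> S (m x) \<omega> > x}
        \<le> prob {\<omega> \<in> space M. S (m x) \<omega> \<le> real (m x) * (y * \<mu>)}"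
      using mx by (intro finite_measure_mono) auto
    ultimately have P: "prob {\<omega> \<in> space M. S (m x) \<omega> > x} \<ge> 1 - e"
      using elim(1) by linarith
    have T: "T (x / \<mu>) \<le> (1 + e) * T (z x)" using elim(2) y by (simp add: z_def)
    show ?case
    proof (cases "c \<ge> 1")
      case True
      then have "(1 - c) * T (x / \<mu>) \<le> 0" by (simp add: T_def mult_nonpos_nonneg)
      then show ?thesis using measure_nonneg order_trans by blast
    next
      case False
      have "(1 - c) * T (x / \<mu>) \<le> (1 - c) * ((1 + e) * T (z x))"
        using False T by (intro mult_left_mono) auto
      also have "\<dots> \<le> (1 - e) * T (z x)"
      proof -
        have "(1 - c) * (1 + e) \<le> (1 - 2 * e) * (1 + e)"
          using e by (intro mult_right_mono) auto
        also have "\<dots> \<le> 1 - e" by (simp add: algebra_simps)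
        finally show ?thesis
          unfolding mult.assoc[symmetric] by (intro mult_right_mono) (simp_all add: T_def)
      qed
      also have "\<dots> \<le> T (z x) * prob {\<omega> \<in> space M. S (m x) \<omega> > x}"
        using P by (subst mult.commute, intro mult_left_mono) (simp_all add: T_def)
      also have "\<dots> \<le> prob {\<omega> \<in> space M. S (N \<omega>) \<omega> > x}"
        by (intro random_sum_ge z0) (simp add: m_def)
      finally show ?thesis .
    qed
  qed
qed

lemma random_sum_upper_bound:
  assumes p: "p > 0" and y: "0 < y" "y < 1"
    and \<mu>: "\<mu> = (\<integral>\<omega>. X 1 \<omega> \<partial>M)" "\<mu> > 0"
  obtains v C where "v > 0"
    "eventually (\<lambda>x. prob {\<omega> \<in> space M. S (N \<omega>) \<omega> > x}
      \<le> T (x / \<mu> * y) + prob {\<omega> \<in> space M. X 1 \<omega> > v * x} * G (y / \<mu> * x) + C * x powr - p) at_top"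
proof -
  \<comment> \<open>For \<open>n \<le> y * x / \<mu>\<close> the mean \<open>n * \<mu>\<close> is at
    most \<open>y * x\<close>, so \<open>S n > x\<close> is a deviation by at least
    \<open>d * x\<close>. In terms of \<open>d * x\<close> the range of \<open>n\<close> has the
    slope \<open>y / (\<mu> * d)\<close>.\<close>
  define d where "d = 1 - y"
  have d: "d > 0" using y by (simp add: d_def)
  obtain v C where v: "v > 0" "C > 0" and FN:
    "\<And>n x. real n \<le> y / (\<mu> * d) * x \<Longrightarrow> x \<ge> 1 / v \<Longrightarrow>
       prob {\<omega> \<in> space M. S n \<omega> > real n * \<mu> + x}
         \<le> real n * prob {\<omega> \<in> space M. X 1 \<omega> > v * x} + C * x powr - p"
    using Fuk_Nagaev[OF p, of "y / (\<mu> * d)"] y d \<mu> by auto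
  have "eventually (\<lambda>x. prob {\<omega> \<in> space M. S (N \<omega>) \<omega> > x}
      \<le> T (x / \<mu> * y) + prob {\<omega> \<in> space M. X 1 \<omega> > v * d * x} * G (y / \<mu> * x)
        + C * d powr - p * x powr - p) at_top"
    using eventually_ge_at_top[of "1 / (v * d)"]
  proof eventually_elim
    case (elim x)
    have x: "x > 0" using elim v d by (meson less_le_trans mult_pos_pos zero_less_divide_1_iff)
    define z where "z = y / \<mu> * x"
    define F where "F = prob {\<omega> \<in> space M. X 1 \<omega> > v * d * x}"
    have z: "z \<ge> 0" using x y \<mu> by (simp add: z_def)
    have S_le: "prob {\<omega> \<in> space M. S n \<omega> > x} \<le> real n * F + C * (d * x) powr - p" if n: "n \<le> nat \<lfloor>z\<rfloor>" for n
    proof -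
      have nz: "real n \<le> z" using n z by (simp add: le_nat_iff le_floor_iff)
      have "real n * \<mu> \<le> y * x" using nz \<mu> by (simp add: z_def field_simps)
      then have "prob {\<omega> \<in> space M. S n \<omega> > x} \<le> prob {\<omega> \<in> space M. S n \<omega> > real n * \<mu> + d * x}"
        by (intro finite_measure_mono) (auto simp: d_def algebra_simps)
      also have "\<dots> \<le> real n * prob {\<omega> \<in> space M. X 1 \<omega> > v * (d * x)} + C * (d * x) powr - p"
        using nz d \<mu> v elim by (intro FN) (auto simp: z_def field_simps)
      finally show ?thesis by (simp add: F_def mult.assoc)
    qed
    have "prob {\<omega> \<in> space M. S (N \<omega>) \<omega> > x}
        \<le> T z + (\<Sum>n\<le>nat \<lfloor>z\<rfloor>. prob {\<omega> \<in> space M. N \<omega> = n} * prob {\<omega> \<in> space M. S n \<omega> > x})"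
      by (rule random_sum_le[OF z])
    also have "(\<Sum>n\<le>nat \<lfloor>z\<rfloor>. prob {\<omega> \<in> space M. N \<omega> = n} * prob {\<omega> \<in> space M. S n \<omega> > x})
        \<le> (\<Sum>n\<le>nat \<lfloor>z\<rfloor>. prob {\<omega> \<in> space M. N \<omega> = n} * (real n * F + C * (d * x) powr - p))"
      by (intro sum_mono mult_left_mono S_le) auto
    \<comment> \<open>Averaging over \<open>N\<close> turns the factor \<open>n\<close> into the
      truncated mean, while the polynomial term keeps a weight of at most 1.\<close>
    also have "\<dots> = F * G z + C * (d * x) powr - p * (\<Sum>n\<le>nat \<lfloor>z\<rfloor>. prob {\<omega> \<in> space M. N \<omega> = n})"
      unfolding G_eq_sum[OF z] sum_distrib_left sum.distrib[symmetric]
      by (intro sum.cong) (auto simp: algebra_simps)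
    also have "\<dots> \<le> F * G z + C * (d * x) powr - p * 1"
      using v by (intro add_left_mono mult_left_mono prob_N_sum_le_1) auto
    also have "(d * x) powr - p = d powr - p * x powr - p"
      using d x by (simp add: powr_mult)
    finally show ?case by (simp add: z_def F_def algebra_simps)
  qed
  then show ?thesis using v d by (intro that[of "v * d" "C * d powr - p"]) auto
qed

text \<open>The hypothesis \<open>err\<close> isolates the only estimate that depends on which of
  the two conditions holds.\<close>

theorem random_sum_asymp_equiv:
  assumes cv: "consistently_varying_tail (cdf (distr M borel (\<lambda>\<omega>. real (N \<omega>))))"
    and \<mu>: "\<mu> = (\<integral>\<omega>. X 1 \<omega> \<partial>M)" "\<mu> > 0"
    and err: "\<And>v k. v > 0 \<Longrightarrow> k > 0 \<Longrightarrow>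
      (\<lambda>x. prob {\<omega> \<in> space M. X 1 \<omega> > v * x} * G (k * x)) \<in> o(T)"
  shows "(\<lambda>x. prob {\<omega> \<in> space M. S (N \<omega>) \<omega> > x}) \<sim>[at_top] (\<lambda>x. T (x / \<mu>))"
proof (rule smallo_imp_asymp_equiv, rule landau_o.smallI)
  fix c :: real assume c: "c > 0"
  have T_pos: "T x > 0" for x
    using cv unfolding consistently_varying_tail_def tail_fun_N by blast
  obtain y0 where y0: "0 < y0" "y0 < 1" "eventually (\<lambda>x. T (x * y0) \<le> 2 * T x) at_top"
    using consistently_varying_tailD[OF cv, of 1] unfolding tail_fun_N by auto
  obtain p where p: "p > 0" "(\<lambda>x. x powr - p) \<in> o(T)"
    using powr_smallo_tail[OF antimono_T T_pos y0] .
  have scale: "filterlim (\<lambda>x. x / \<mu>) at_top at_top"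
    by (rule filterlim_divide_at_top[OF \<mu>(2)])
  \<comment> \<open>Errors come out as \<open>o(T)\<close>; this converts them to errors relative to
    \<open>T (x / \<mu>)\<close>.\<close>
  have T_scale: "T \<in> O(\<lambda>x. T (x / \<mu>))"
    using landau_o.big.compose[OF tail_bigo_scale[OF antimono_T T_pos y0 \<mu>(2)] scale] \<mu> by simp
  \<comment> \<open>Half of the tolerance \<open>c\<close> pays for replacing
    \<open>T (x / \<mu> * y)\<close> by \<open>T (x / \<mu>)\<close>, the other half for the error
    terms.\<close>
  obtain y where y: "0 < y" "y < 1" "eventually (\<lambda>x. T (x * y) \<le> (1 + c / 2) * T x) at_top"
    using consistently_varying_tailD[OF cv, of "c / 2"] c unfolding tail_fun_N by auto
  obtain v C where v: "v > 0" and upper: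
    "eventually (\<lambda>x. prob {\<omega> \<in> space M. S (N \<omega>) \<omega> > x}
      \<le> T (x / \<mu> * y) + prob {\<omega> \<in> space M. X 1 \<omega> > v * x} * G (y / \<mu> * x) + C * x powr - p) at_top"
    using random_sum_upper_bound[OF p(1) y(1,2) \<mu>] .
  have "(\<lambda>x. prob {\<omega> \<in> space M. X 1 \<omega> > v * x} * G (y / \<mu> * x) + C * x powr - p) \<in> o(T)"
    using y \<mu> v p by (intro sum_in_smallo err) auto
  from landau_o.small_big_trans[OF this T_scale]
  have error: "eventually (\<lambda>x. norm (prob {\<omega> \<in> space M. X 1 \<omega> > v * x} * G (y / \<mu> * x) + C * x powr - p)
      \<le> c / 2 * norm (T (x / \<mu>))) at_top"
    using c by (intro landau_o.smallD) auto
  from upper eventually_compose_filterlim[OF y(3) scale] random_sum_lower[OF cv \<mu> c] error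
  show "eventually (\<lambda>x. norm (prob {\<omega> \<in> space M. S (N \<omega>) \<omega> > x} - T (x / \<mu>)) \<le> c * norm (T (x / \<mu>))) at_top"
  proof eventually_elim
    case (elim x)
    have "prob {\<omega> \<in> space M. X 1 \<omega> > v * x} * G (y / \<mu> * x) + C * x powr - p \<le> c / 2 * T (x / \<mu>)"
      using elim(4) T_pos[of "x / \<mu>"] by (simp only: real_norm_def abs_of_pos abs_le_iff)
    then show ?case
      using elim(1-3) T_pos[of "x / \<mu>"] by (simp add: abs_le_iff algebra_simps)
  qed
qed

section \<open>Negligibility of the single-jump error under each of the two conditions\<close>

lemma error_smallo_finite_mean:
  assumes T: "\<And>c. c > 0 \<Longrightarrow> (\<lambda>x. T (c * x)) \<in> O(T)" and v: "v > 0"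
    and mean: "(\<integral>\<^sup>+\<omega>. of_nat (N \<omega>) \<partial>M) < \<infinity>"
    and X: "(\<lambda>x. prob {\<omega> \<in> space M. X 1 \<omega> > x}) \<in> o(T)"
  shows "(\<lambda>x. prob {\<omega> \<in> space M. X 1 \<omega> > v * x} * G (k * x)) \<in> o(T)"
proof -
  have int: "integrable M (\<lambda>\<omega>. real (N \<omega>))"
    using mean by (intro integrableI_nonneg) (auto simp: ennreal_of_nat_eq_real_of_nat)
  have "G z \<le> (\<integral>\<omega>. real (N \<omega>) \<partial>M)" for z
    unfolding G_def
  proof (rule integral_mono[OF _ int])
    show "integrable M (\<lambda>\<omega>. real (N \<omega>) * indicator {\<omega>. real (N \<omega>) \<le> z} \<omega>)"
      by (rule Bochner_Integration.integrable_bound[OF int]) (auto simp: indicator_def)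
  qed (auto simp: indicator_def)
  \<comment> \<open>The truncated means never exceed \<open>E[N]\<close>, so the smallness of the
    product comes from the tail of \<open>X 1\<close> alone.\<close>
  then have "(\<lambda>x. G (k * x)) \<in> O(\<lambda>_. 1)"
    using G_nonneg by (intro bigoI[where c = "\<integral>\<omega>. real (N \<omega>) \<partial>M"]) simp
  moreover have "filterlim (\<lambda>x. v * x) at_top at_top" using v by real_asymp
  from landau_o.small.compose[OF X this]
  have "(\<lambda>x. prob {\<omega> \<in> space M. X 1 \<omega> > v * x}) \<in> o(T)"
    by (rule landau_o.small_big_trans[OF _ T[OF v]])
  ultimately show ?thesis
    using landau_o.small_big_mult by fastforce
qed

text \<open>The tail of \<open>X 1\<close> is \<open>O(x powr - r)\<close> by the moment, and the
  truncated mean is \<open>O(x powr q * T x)\<close> by the upper limit. Since \<open>q < r\<close>,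
  the product is negligible against \<open>T\<close>.\<close>

lemma error_smallo_truncated_mean:
  assumes T: "\<And>c. c > 0 \<Longrightarrow> (\<lambda>x. T (c * x)) \<in> O(T)" and T_pos: "\<And>x. T x > 0"
    and v: "v > 0" and k: "k > 0" and q: "0 < q" "q < r"
    and moment: "integrable M (\<lambda>\<omega>. X 1 \<omega> powr r)"
    and lim: "Limsup at_top (\<lambda>x. ereal (G x / (x powr q * T x))) < \<infinity>"
  shows "(\<lambda>x. prob {\<omega> \<in> space M. X 1 \<omega> > v * x} * G (k * x)) \<in> o(T)"
proof -
  obtain C where "Limsup at_top (\<lambda>x. ereal (G x / (x powr q * T x))) < ereal C"
    using less_PInf_Ex_of_nat lim by auto
  from Limsup_lessD[OF this] have "eventually (\<lambda>x. G x / (x powr q * T x) < C) at_top" by simp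
  then have "eventually (\<lambda>x. norm (G x) \<le> C * norm (x powr q * T x)) at_top"
    using eventually_gt_at_top[of 0]
  proof eventually_elim
    case (elim x)
    then show ?case using T_pos[of x] G_nonneg[of x] by (simp add: field_simps)
  qed
  then have G: "G \<in> O(\<lambda>x. x powr q * T x)" by (rule bigoI)
  have lim: "filterlim (\<lambda>x. c * x) at_top at_top" if "c > 0" for c :: real
    using that by real_asymp
  have "(\<lambda>x. G (k * x)) \<in> O(\<lambda>x. (k * x) powr q * T (k * x))"
    by (rule landau_o.big.compose[OF G lim[OF k]])
  also have "(\<lambda>x. (k * x) powr q * T (k * x)) \<in> O(\<lambda>x. x powr q * T x)"
  proof (rule landau_o.big.mult[OF _ T[OF k]])
    show "(\<lambda>x. (k * x) powr q) \<in> O(\<lambda>x. x powr q)"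
      using k by real_asymp
  qed
  finally have G': "(\<lambda>x. G (k * x)) \<in> O(\<lambda>x. x powr q * T x)" .
  have "(\<lambda>x. prob {\<omega> \<in> space M. X 1 \<omega> > v * x}) \<in> O(\<lambda>x. (v * x) powr - r)"
    using q X_measurable[of 1]
    by (intro landau_o.big.compose[OF prob_gt_bigo_powr lim[OF v]] moment) auto
  also have "(\<lambda>x. (v * x) powr - r) \<in> O(\<lambda>x. x powr - r)"
    using v by real_asymp
  finally have "(\<lambda>x. prob {\<omega> \<in> space M. X 1 \<omega> > v * x} * G (k * x))
      \<in> O(\<lambda>x. x powr - r * (x powr q * T x))"
    using G' by (rule landau_o.big.mult)
  also have "(\<lambda>x. x powr - r * (x powr q * T x)) \<in> o(\<lambda>x. 1 * T x)"
    unfolding mult.assoc[symmetric]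
  proof (rule landau_o.small_big_mult[OF _ landau_o.big_refl])
    have "((\<lambda>x. x powr (q - r)) \<longlongrightarrow> 0) at_top"
      using q by (intro tendsto_neg_powr filterlim_ident) auto
    then show "(\<lambda>x. x powr - r * x powr q) \<in> o(\<lambda>_. 1)"
      by (intro smalloI_tendsto) (simp_all flip: powr_add)
  qed
  finally show ?thesis by simp
qed

end

theorem theorem3p2:
  fixes M :: "'a measure"
    and N :: "'a \<Rightarrow> nat"
    and X :: "nat \<Rightarrow> 'a \<Rightarrow> real"
    and \<mu> r :: real
  assumes "prob_space M"
    and N_rv: "N \<in> measurable M (count_space UNIV)"
    and X_rv: "\<And>i. i \<ge> 1 \<Longrightarrow> X i \<in> borel_measurable M"
    and X_nonneg: "\<And>i. i \<ge> 1 \<Longrightarrow> AE \<omega> in M. X i \<omega> \<ge> 0"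
    and X_indep: "prob_space.indep_vars M (\<lambda>_. borel) X {1..}"
    and X_ident: "\<And>i. i \<ge> 1 \<Longrightarrow> distr M borel (X i) = distr M borel (X 1)"
    and X_mean_finite: "integrable M (X 1)"
    and \<mu>_def: "\<mu> = (\<integral>\<omega>. X 1 \<omega> \<partial>M)"
    and \<mu>_pos: "\<mu> > 0"
    and N_X_indep: "prob_space.indep_rvs M (count_space UNIV) N
                      (PiM {1..} (\<lambda>_. borel)) (\<lambda>\<omega>. \<lambda>i\<in>{1..}. X i \<omega>)"
    and N_tail: "consistently_varying_tail (cdf (distr M borel (\<lambda>\<omega>. real (N \<omega>))))"
    and r_gt_1: "r > 1"
    and X_moment: "integrable M (\<lambda>\<omega>. X 1 \<omega> powr r)"
    and cond:
      "(\<integral>\<^sup>+\<omega>. of_nat (N \<omega>) \<partial>M) < \<infinity> \<and>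
         (\<lambda>x. \<P>(\<omega> in M. X 1 \<omega> > x)) \<in> o[at_top](\<lambda>x. \<P>(\<omega> in M. real (N \<omega>) > x))
       \<or>
       (\<integral>\<^sup>+\<omega>. of_nat (N \<omega>) \<partial>M) = \<infinity> \<and>
         (\<exists>q. 1 \<le> q \<and> q < r \<and>
            Limsup at_top (\<lambda>x::real. ereal
              ((\<integral>\<omega>. real (N \<omega>) * indicator {\<omega>. real (N \<omega>) \<le> x} \<omega> \<partial>M) /
               (x powr q * \<P>(\<omega> in M. real (N \<omega>) > x)))) < \<infinity>)"
  shows "(\<lambda>x. \<P>(\<omega> in M. (\<Sum>i=1..N \<omega>. X i \<omega>) > x))
           \<sim>[at_top] (\<lambda>x. \<P>(\<omega> in M. real (N \<omega>) > x / \<mu>))"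
proof -
  \<comment> \<open>The Chernoff estimates use a moment of order between 1 and 2; the full order
    \<open>r\<close> is still needed to compare with \<open>q\<close>.\<close>
  define s where "s = min r 2"
  interpret prob_space M by fact
  have X1: "X 1 \<in> borel_measurable M" "AE \<omega> in M. X 1 \<omega> \<ge> 0"
    using X_rv X_nonneg by auto
  interpret random_sum M X s N
  proof (unfold_locales; (fact X_indep X_ident X1 X_mean_finite N_X_indep)?)
    show "1 < s" "s \<le> 2" using r_gt_1 by (auto simp: s_def)
    show "integrable M (\<lambda>\<omega>. X 1 \<omega> powr s)"
      by (rule integrable_powr_le[OF X1 _ _ X_moment]) (use r_gt_1 in \<open>simp_all add: s_def\<close>)
  qed
  have T_pos: "T x > 0" for x
    using N_tail unfolding consistently_varying_tail_def tail_fun_N by blast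
  obtain y where y: "0 < y" "y < 1" "eventually (\<lambda>x. T (x * y) \<le> 2 * T x) at_top"
    using consistently_varying_tailD[OF N_tail, of 1] unfolding tail_fun_N by auto
  note T_scale = tail_bigo_scale[OF antimono_T T_pos y]
  \<comment> \<open>In both cases rescaling of the arguments is absorbed by \<open>T_scale\<close>,
    so any positive \<open>v\<close> and \<open>k\<close> are allowed.\<close>
  have "(\<lambda>x. prob {\<omega> \<in> space M. X 1 \<omega> > v * x} * G (k * x)) \<in> o(T)" if "v > 0" "k > 0" for v k
    using cond
  proof (elim disjE conjE exE)
    assume "(\<integral>\<^sup>+\<omega>. of_nat (N \<omega>) \<partial>M) < \<infinity>"
      "(\<lambda>x. \<P>(\<omega> in M. X 1 \<omega> > x)) \<in> o[at_top](\<lambda>x. \<P>(\<omega> in M. real (N \<omega>) > x))"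
    then show ?thesis
      unfolding T_def[symmetric] using that by (intro error_smallo_finite_mean T_scale) auto
  next
    fix q
    assume "1 \<le> q" "q < r" "Limsup at_top (\<lambda>x::real. ereal
              ((\<integral>\<omega>. real (N \<omega>) * indicator {\<omega>. real (N \<omega>) \<le> x} \<omega> \<partial>M) /
               (x powr q * \<P>(\<omega> in M. real (N \<omega>) > x)))) < \<infinity>"
    then show ?thesis
      unfolding T_def[symmetric] G_def[symmetric] using that \<open>integrable M (\<lambda>\<omega>. X 1 \<omega> powr r)\<close>
      by (intro error_smallo_truncated_mean[where q = q and r = r] T_scale T_pos) simp_all
  qed
  from random_sum_asymp_equiv[OF N_tail \<mu>_def \<mu>_pos this]
  show ?thesis unfolding S_def T_def .
qed

end
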